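(* Let $(X,X_+,\mathcal{K},f)$ be an abstract state space and let $\{P_n\}_{n\ge1}$ and $\{\bar{P}_n\}_{n\ge1}$ be left decreasing sequences of Markov projections of $X$ such that $\|P_n-\bar{P}_n\|\to0$ and $P_n\to P$ in norm as $n\to\infty$. Let $\{T_n\}_{n\ge1}$ and $\{S_n\}_{n\ge1}$ be sequences of Markov operators on $X$, the generating sequences of the NDMCs $\{T^{m,n}\}$ and $\{S^{m,n}\}$, such that for all $n\in\mathbb{N}$ one has $T_nP_n=P_nT_n$, $S_n\bar{P}_n=\bar{P}_nS_n$, $T_nP_n=P_n$, $S_n\bar{P}_n=\bar{P}_n$, and such that $\sum_{n=1}^\infty\|T_n-S_n\|<\infty$. Then $\{T^{m,n}\}$ is weakly $P$-ergodic if and only if $\{S^{m,n}\}$ is weakly $P$-ergodic.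
   Context: Abstract state space: $X$ is a real ordered vector space with generating cone $X_+=\{x\in X: x\ge 0\}$ (i.e. $X=X_+-X_+$), $f$ is a strictly positive linear functional on $X$ ($f(x)>0$ for $x>0$), and $\mathcal{K}=\{x\in X_+: f(x)=1\}$. With $U$ the convex hull of $\mathcal{K}\cup(-\mathcal{K})$, put $\|x\|=\inf\{\lambda\in\mathbb{R}_+: x\in\lambda U\}$. $(X,X_+,\mathcal{K},f)$ is an abstract state space if $\|\cdot\|$ is a norm, $X$ is complete for it, and $X_+$ is closed. $X$ always carries this norm, and norms of operators are the induced operator norms. Markov operator: a linear $T:X\to X$ that is positive and satisfies $T(\mathcal{K})\subset\mathcal{K}$ (then $\|T\|=1$). Markov projection: a Markov operator $P$ with $P^2=P$. $\mathbb{N}=\{1,2,\dots\}$. The nonhomogeneous discrete Markov chain (NDMC) generated by $\{T_n\}_{n\ge1}$ is the family $T^{k,n}=T_nT_{n-1}\cdots T_{k+1}$, $0\le k<n$; similarly $S^{k,n}=S_nS_{n-1}\cdots S_{k+1}$. A sequence of projections $\{P_n\}$ is left decreasing if $P_{n+1}P_n=P_{n+1}$ for all $n\in\mathbb{N}$. Generalized Dobrushin coefficient: for a projection $P\neq I$, $N_P=\{x\in X: Px=0\}$ and $\delta_P(T)=\sup_{x\in N_P,\,x\ne0}\|Tx\|/\|x\|$ for bounded linear $T$; by convention $\delta_I(T)=1$. An NDMC $\{T^{m,n}\}$ is weakly $P$-ergodic if $\lim_{n\to\infty}\delta_P(T^{m,n})=0$ for every $m\ge0$. *)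

theory Defs
  imports "HOL-Analysis.Analysis"
begin

definition base_set :: "('a::{banach, ordered_real_vector} \<Rightarrow> real) \<Rightarrow> 'a set" where
  "base_set f = {x. 0 \<le> x \<and> f x = 1}"

definition unit_hull :: "('a::{banach, ordered_real_vector} \<Rightarrow> real) \<Rightarrow> 'a set" where
  "unit_hull f = convex hull (base_set f \<union> uminus ` base_set f)"

(* The space X is the whole type; its order is that of class ordered_real_vector. The requirements
   that the Minkowski functional of unit_hull f is a norm and that X is complete for it are expressed by
   the class banach together with the last conjunct, which identifies the norm of the class with
   this functional. The set under the infimum is nonempty except when X = {0}, where base_set f is empty. *)
definition abstract_state_space :: "('a::{banach, ordered_real_vector} \<Rightarrow> real) \<Rightarrow> bool" where
  "abstract_state_space f \<longleftrightarrow>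
     (\<forall>x::'a. \<exists>u v. 0 \<le> u \<and> 0 \<le> v \<and> x = u - v) \<and>
     linear f \<and> (\<forall>x>0. f x > 0) \<and>
     closed {x::'a. 0 \<le> x} \<and>
     (\<forall>x. norm x = Inf {l. 0 \<le> l \<and> x \<in> (*\<^sub>R) l ` unit_hull f})"

definition markov_operator ::
  "('a::{banach, ordered_real_vector} \<Rightarrow> real) \<Rightarrow> ('a \<Rightarrow> 'a) \<Rightarrow> bool" where
  "markov_operator f T \<longleftrightarrow>
     linear T \<and> (\<forall>x\<ge>0. 0 \<le> T x) \<and> T ` base_set f \<subseteq> base_set f"

definition markov_projection ::
  "('a::{banach, ordered_real_vector} \<Rightarrow> real) \<Rightarrow> ('a \<Rightarrow> 'a) \<Rightarrow> bool" where
  "markov_projection f P \<longleftrightarrow> markov_operator f P \<and> P \<circ> P = P"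

(* Sequences are indexed by n \<ge> 1; the entry at index 0 is never constrained nor used. *)
definition left_decreasing :: "(nat \<Rightarrow> 'a \<Rightarrow> 'a) \<Rightarrow> bool" where
  "left_decreasing P \<longleftrightarrow> (\<forall>n\<ge>1. P (n + 1) \<circ> P n = P (n + 1))"

(* ndmc T k n = T n \<circ> \<dots> \<circ> T (k + 1) for k < n; for n \<le> k it is the empty composition. *)
primrec ndmc :: "(nat \<Rightarrow> 'a \<Rightarrow> 'a) \<Rightarrow> nat \<Rightarrow> nat \<Rightarrow> 'a \<Rightarrow> 'a" where
  "ndmc T k 0 = id"
| "ndmc T k (Suc n) = (if k \<le> n then T (Suc n) \<circ> ndmc T k n else id)"

(* The supremum is that of a nonempty bounded set when P is a projection other than the identity
   and T is bounded linear. *)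
definition dobrushin_coeff ::
  "('a::real_normed_vector \<Rightarrow> 'a) \<Rightarrow> ('a \<Rightarrow> 'a) \<Rightarrow> real" where
  "dobrushin_coeff P T =
     (if P = id then 1 else (SUP x\<in>{x. P x = 0 \<and> x \<noteq> 0}. norm (T x) / norm x))"

definition weakly_ergodic ::
  "('a::real_normed_vector \<Rightarrow> 'a) \<Rightarrow> (nat \<Rightarrow> 'a \<Rightarrow> 'a) \<Rightarrow> bool" where
  "weakly_ergodic P T \<longleftrightarrow> (\<forall>m. (\<lambda>n. dobrushin_coeff P (ndmc T m n)) \<longlonglongrightarrow> 0)"

end

theory Submission
  imports Defs
begin

text \<open>
  Two observations carry the proof.

  The first is an invariance. For a left decreasing sequence \<open>Q\<close> one has \<open>Q n \<circ> Q j = Q n\<close>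
  whenever \<open>j \<le> n\<close>, and the hypotheses on the operator \<open>R j\<close> give \<open>Q j \<circ> R j = Q j\<close>. Hence
  \<open>Q n \<circ> R j = Q n \<circ> Q j \<circ> R j = Q n\<close> for every \<open>n \<ge> j\<close>, and letting \<open>n\<close> grow shows that the limit
  projection absorbs every \<open>R j\<close> exactly (\<open>limit_projection_absorbs\<close>). As both sequences of projections
  have the same limit, both chains map its kernel into itself.

  The second is a comparison. Markov operators are contractions, since they map the unit hull,
  whose Minkowski functional is the norm, into itself (\<open>markov_operator_norm_le\<close>). Telescoping
  therefore bounds the distance between the two chains from time \<open>k\<close> on by the tail of the series of
  the \<open>\<parallel>T i - S i\<parallel>\<close>, uniformly in the final time (\<open>ndmc_diff_norm_le\<close>). Now let \<open>x\<close> lie in the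
  kernel of the limit projection, and put \<open>y = S\<^sup>m\<^sup>,\<^sup>k x\<close>. This vector is again in the kernel and is not
  longer than \<open>x\<close>, so that
    \<open>\<parallel>S\<^sup>m\<^sup>,\<^sup>n x\<parallel> = \<parallel>S\<^sup>k\<^sup>,\<^sup>n y\<parallel> \<le> \<parallel>T\<^sup>k\<^sup>,\<^sup>n y\<parallel> + tail k * \<parallel>y\<parallel> \<le> (\<delta> (T\<^sup>k\<^sup>,\<^sup>n) + tail k) * \<parallel>x\<parallel>\<close>.
  Taking first \<open>k\<close> and then \<open>n\<close> large transfers weak ergodicity from \<open>T\<close> to \<open>S\<close>
  (\<open>weakly_ergodic_transfer\<close>); the situation is symmetric in the two chains.
\<close>

section \<open>Markov operators are contractions\<close>

text \<open>The infimum defining the norm runs over a nonempty set, so that it can be compared with the one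
  of another vector. The vector \<open>0\<close> is left out because the hull is empty in the zero space.\<close>

lemma ex_scale_unit_hull:
  fixes f :: "'a::{banach, ordered_real_vector} \<Rightarrow> real"
  assumes ass: "abstract_state_space f" and "x \<noteq> 0"
  shows "\<exists>l\<ge>0. x \<in> (*\<^sub>R) l ` unit_hull f"
proof -
  have lin: "linear f" and pos: "\<And>x. x > 0 \<Longrightarrow> f x > 0"
    using ass by (auto simp: abstract_state_space_def)
  obtain u v where uv: "0 \<le> u" "0 \<le> v" "x = u - v"
    using ass unfolding abstract_state_space_def by blast
  have normalised: "f w > 0 \<and> w /\<^sub>R f w \<in> base_set f" if "0 \<le> w" "w \<noteq> 0" for w
  proof -
    have "f w > 0" using pos[of w] that by simp
    then show ?thesis
      using that by (simp add: base_set_def linear_cmul[OF lin] scaleR_nonneg_nonneg)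
  qed
  have plus: "k \<in> unit_hull f" and minus: "- k \<in> unit_hull f" if "k \<in> base_set f" for k
    using that hull_subset[of "base_set f \<union> uminus ` base_set f" convex]
    by (auto simp: unit_hull_def)
  consider "u = 0" "v \<noteq> 0" | "u \<noteq> 0" "v = 0" | "u \<noteq> 0" "v \<noteq> 0"
    using uv \<open>x \<noteq> 0\<close> by auto
  then show ?thesis
  proof cases
    case 1
    then have "x = f v *\<^sub>R (- (v /\<^sub>R f v))" using normalised[of v] uv by simp
    then show ?thesis using 1 normalised[of v] minus uv
      by (intro exI[of _ "f v"]) (auto simp del: scaleR_minus_right)
  next
    case 2
    then have "x = f u *\<^sub>R (u /\<^sub>R f u)" using normalised[of u] uv by simp
    moreover have "u /\<^sub>R f u \<in> unit_hull f" "f u > 0"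
      using 2 normalised[of u] plus uv by auto
    ultimately show ?thesis by (meson image_eqI less_imp_le)
  next
    case 3
    define a b where "a = f u" and "b = f v"
    have a: "a > 0" "u /\<^sub>R a \<in> base_set f" and b: "b > 0" "v /\<^sub>R b \<in> base_set f"
      using 3 uv normalised by (auto simp: a_def b_def)
    define y where "y = (a / (a + b)) *\<^sub>R (u /\<^sub>R a) + (b / (a + b)) *\<^sub>R (- (v /\<^sub>R b))"
    have "convex (unit_hull f)" by (simp add: unit_hull_def)
    then have "y \<in> unit_hull f"
      unfolding y_def using a b plus minus
      by (intro convexD) (auto simp: add_divide_distrib[symmetric])
    moreover have "x = (a + b) *\<^sub>R y"
      using a(1) b(1) uv(3) by (simp add: y_def algebra_simps)
    ultimately show ?thesis using a b by (intro exI[of _ "a + b"]) auto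
  qed
qed

lemma markov_operator_unit_hull:
  assumes "markov_operator f T" "x \<in> unit_hull f"
  shows "T x \<in> unit_hull f"
proof -
  let ?G = "base_set f \<union> uminus ` base_set f"
  have lin: "linear T" and img: "T ` base_set f \<subseteq> base_set f"
    using assms(1) by (auto simp: markov_operator_def)
  have "T ` ?G \<subseteq> ?G"
    using img by (auto simp: linear_neg[OF lin])
  then have "T ` (convex hull ?G) \<subseteq> convex hull ?G"
    by (metis convex_hull_linear_image[OF lin] hull_mono)
  then show ?thesis using assms(2) by (auto simp: unit_hull_def)
qed

lemma markov_operator_norm_le:
  fixes f :: "'a::{banach, ordered_real_vector} \<Rightarrow> real"
  assumes ass: "abstract_state_space f" and T: "markov_operator f T"
  shows "norm (T x) \<le> norm x"
proof (cases "x = 0")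
  case True
  then show ?thesis using T by (simp add: markov_operator_def linear_0)
next
  case False
  let ?L = "\<lambda>x. {l. 0 \<le> l \<and> x \<in> (*\<^sub>R) l ` unit_hull f}"
  have lin: "linear T" using T by (simp add: markov_operator_def)
  have norm_eq: "norm z = Inf (?L z)" for z
    using ass by (simp add: abstract_state_space_def)
  have "?L x \<subseteq> ?L (T x)"
    using markov_operator_unit_hull[OF T] by (auto simp: linear_cmul[OF lin])
  moreover have "?L x \<noteq> {}" using ex_scale_unit_hull[OF ass False] by auto
  moreover have "bdd_below (?L (T x))" by (rule bdd_belowI[of _ 0]) auto
  ultimately have "Inf (?L (T x)) \<le> Inf (?L x)"
    by (intro cInf_superset_mono)
  then show ?thesis by (simp only: norm_eq)
qed

lemma contraction_bounded_linear:
  assumes "linear T" "\<And>x. norm (T x) \<le> norm x"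
  shows "bounded_linear T"
  using assms linear_conv_bounded_linear bounded_linear_intro[of T 1]
  by (simp add: linear_add linear_cmul)

section \<open>Nonhomogeneous chains of contractions\<close>

lemma ndmc_split:
  assumes "m \<le> k" "k \<le> n"
  shows "ndmc T m n = ndmc T k n \<circ> ndmc T m k"
  using \<open>k \<le> n\<close>
proof (induction n rule: dec_induct)
  case base
  have "ndmc T k k = id" by (cases k) auto
  then show ?case by simp
next
  case (step n)
  then show ?case using \<open>m \<le> k\<close> by (simp add: comp_assoc)
qed

lemma ndmc_norm_le:
  fixes T :: "nat \<Rightarrow> 'a::real_normed_vector \<Rightarrow> 'a"
  assumes "\<And>n x. n \<ge> 1 \<Longrightarrow> norm (T n x) \<le> norm x"
  shows "norm (ndmc T m n x) \<le> norm x"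
proof (induction n)
  case (Suc n)
  then show ?case using assms[of "Suc n" "ndmc T m n x"] by (auto intro: order_trans)
qed simp

lemma ndmc_absorbed:
  assumes "\<And>n x. n \<ge> 1 \<Longrightarrow> P (T n x) = P x"
  shows "P (ndmc T m n x) = P x"
  by (induction n) (simp_all add: assms)

text \<open>Telescoping: with \<open>t\<close> and \<open>s\<close> the states of the two chains at time \<open>n\<close>, the next difference is
  \<open>T (t - s) + (T - S) s\<close>, where the first term does not grow because \<open>T\<close> is a contraction, and the
  second one is controlled because \<open>s\<close> is not longer than the starting vector.\<close>

lemma ndmc_diff_norm_le:
  fixes T S :: "nat \<Rightarrow> 'a::real_normed_vector \<Rightarrow> 'a"
  assumes linT: "\<And>n. n \<ge> 1 \<Longrightarrow> linear (T n)"
    and linS: "\<And>n. n \<ge> 1 \<Longrightarrow> linear (S n)"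
    and T1: "\<And>n x. n \<ge> 1 \<Longrightarrow> norm (T n x) \<le> norm x"
    and S1: "\<And>n x. n \<ge> 1 \<Longrightarrow> norm (S n x) \<le> norm x"
    and "k \<le> n"
  shows "norm (ndmc T k n x - ndmc S k n x)
    \<le> (\<Sum>i = k..<n. onorm (\<lambda>x. T (Suc i) x - S (Suc i) x)) * norm x"
  using \<open>k \<le> n\<close>
proof (induction n rule: dec_induct)
  case base
  have "ndmc R k k = id" for R :: "nat \<Rightarrow> 'a \<Rightarrow> 'a" by (cases k) auto
  then show ?case by simp
next
  case (step n)
  let ?t = "ndmc T k n x" and ?s = "ndmc S k n x"
  let ?D = "\<lambda>x. T (Suc n) x - S (Suc n) x"
  have bl: "bounded_linear ?D"
    using linT linS T1 S1 by (intro bounded_linear_sub contraction_bounded_linear) auto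
  have "ndmc T k (Suc n) x - ndmc S k (Suc n) x = T (Suc n) (?t - ?s) + ?D ?s"
    using step(1) by (simp add: linear_diff[OF linT])
  also have "norm \<dots> \<le> norm (?t - ?s) + onorm ?D * norm ?s"
    using T1[of "Suc n" "?t - ?s"] onorm[OF bl, of ?s] by (intro norm_triangle_mono) auto
  also have "\<dots> \<le> norm (?t - ?s) + onorm ?D * norm x"
    using ndmc_norm_le[OF S1] onorm_pos_le[OF bl] by (intro add_left_mono mult_left_mono) auto
  also have "\<dots> \<le> (\<Sum>i = k..<Suc n. onorm (\<lambda>x. T (Suc i) x - S (Suc i) x)) * norm x"
    using step by (simp add: distrib_right)
  finally show ?case .
qed

section \<open>Transfer of weak ergodicity\<close>

lemma dobrushin_coeff_bound:
  fixes R :: "'a::real_normed_vector \<Rightarrow> 'a"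
  assumes "P \<noteq> id" "\<And>x. norm (R x) \<le> norm x" "P x = 0" "x \<noteq> 0"
  shows "norm (R x) / norm x \<le> dobrushin_coeff P R"
proof -
  have "bdd_above ((\<lambda>x. norm (R x) / norm x) ` {x. P x = 0 \<and> x \<noteq> 0})"
    using assms(2) by (intro bdd_aboveI[of _ 1]) (auto simp: divide_le_eq_1)
  then show ?thesis using assms by (auto simp: dobrushin_coeff_def intro!: cSUP_upper)
qed

text \<open>The invariance \<open>P \<circ> S n = P\<close> makes the intermediate state of the chain \<open>S\<close> a vector at which
  the coefficient of \<open>T\<close> gives a bound. Two degenerate cases are settled by the definition of the coefficient: when \<open>P\<close>
  is the identity no chain is weakly ergodic, and when the kernel is trivial the coefficient does
  not depend on the operator.\<close>

lemma weakly_ergodic_transfer: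
  fixes T S :: "nat \<Rightarrow> 'a::real_normed_vector \<Rightarrow> 'a"
  assumes linT: "\<And>n. n \<ge> 1 \<Longrightarrow> linear (T n)"
    and linS: "\<And>n. n \<ge> 1 \<Longrightarrow> linear (S n)"
    and T1: "\<And>n x. n \<ge> 1 \<Longrightarrow> norm (T n x) \<le> norm x"
    and S1: "\<And>n x. n \<ge> 1 \<Longrightarrow> norm (S n x) \<le> norm x"
    and PS: "\<And>n x. n \<ge> 1 \<Longrightarrow> P (S n x) = P x"
    and sm: "summable (\<lambda>n. onorm (\<lambda>x. T (Suc n) x - S (Suc n) x))"
    and erg: "weakly_ergodic P T"
  shows "weakly_ergodic P S"
proof (cases "P = id")
  case True
  then show ?thesis using erg by (simp add: weakly_ergodic_def dobrushin_coeff_def)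
next
  case nonid: False
  let ?N = "{x. P x = 0 \<and> x \<noteq> 0}"
  show ?thesis
  proof (cases "?N = {}")
    case True
    then show ?thesis using erg nonid by (simp only: weakly_ergodic_def dobrushin_coeff_def) simp
  next
    case False
    define d where "d i = onorm (\<lambda>x. T (Suc i) x - S (Suc i) x)" for i
    have d0: "d i \<ge> 0" for i
      unfolding d_def using linT linS T1 S1
      by (intro onorm_pos_le bounded_linear_sub contraction_bounded_linear) auto
    have smd: "summable d" using sm by (simp add: d_def[abs_def])
    show ?thesis unfolding weakly_ergodic_def
    proof (intro allI LIMSEQ_I)
      fix m and e :: real assume "e > 0"
      obtain K where K: "\<And>k. k \<ge> K \<Longrightarrow> norm (\<Sum>i. d (i + k)) < e / 2"
        using suminf_exist_split[OF _ smd] \<open>e > 0\<close> by (metis half_gt_zero)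
      define k where "k = max m K"
      define tail where "tail = (\<Sum>i. d (i + k))"
      have tail: "tail < e / 2" using K[of k] by (simp add: k_def tail_def)
      have partial: "(\<Sum>i = k..<n. d i) \<le> tail" for n
      proof -
        have "(\<Sum>i = k..<n. d i) = (\<Sum>i<n - k. d (i + k))"
          by (cases "k \<le> n") (auto simp: sum.atLeastLessThan_shift_0 atLeast0LessThan add.commute)
        also have "\<dots> \<le> tail" unfolding tail_def
          using d0 smd by (intro sum_le_suminf) (auto simp: summable_iff_shift)
        finally show ?thesis .
      qed
      have "(\<lambda>n. dobrushin_coeff P (ndmc T k n)) \<longlonglongrightarrow> 0"
        using erg by (simp add: weakly_ergodic_def)
      from LIMSEQ_D[OF this, of "e / 2"] \<open>e > 0\<close>
      obtain M where M: "\<And>n. n \<ge> M \<Longrightarrow> dobrushin_coeff P (ndmc T k n) < e / 2"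
        by fastforce
      show "\<exists>n0. \<forall>n\<ge>n0. norm (dobrushin_coeff P (ndmc S m n) - 0) < e"
      proof (intro exI[of _ "max M k"] allI impI)
        fix n assume n: "max M k \<le> n"
        let ?c = "dobrushin_coeff P (ndmc T k n)"
        have bound: "norm (ndmc S m n x) / norm x \<le> ?c + tail" if x: "x \<in> ?N" for x
        proof -
          define y where "y = ndmc S m k x"
          have Py: "P y = 0" using x by (simp add: y_def ndmc_absorbed[of P, OF PS])
          have ny: "norm y \<le> norm x" unfolding y_def by (rule ndmc_norm_le[OF S1])
          have "ndmc S m n x = ndmc S k n y"
            using ndmc_split[where T = S and m = m and k = k and n = n] n by (simp add: k_def y_def)
          moreover have "norm (ndmc S k n y) \<le> (?c + tail) * norm y"
          proof (cases "y = 0")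
            case True
            then show ?thesis using ndmc_norm_le[OF S1, where m = k and n = n and x = y] by simp
          next
            case False
            have "norm (ndmc T k n y) / norm y \<le> ?c"
              using False Py by (intro dobrushin_coeff_bound nonid ndmc_norm_le[OF T1])
            then have t: "norm (ndmc T k n y) \<le> ?c * norm y"
              using False by (simp add: divide_le_eq)
            have "norm (ndmc T k n y - ndmc S k n y) \<le> (\<Sum>i = k..<n. d i) * norm y"
              unfolding d_def using n by (intro ndmc_diff_norm_le linT linS T1 S1) auto
            also have "\<dots> \<le> tail * norm y" by (intro mult_right_mono partial) auto
            finally have "norm (ndmc T k n y - ndmc S k n y) \<le> tail * norm y" .
            then show ?thesis
              using t norm_triangle_ineq3[of "ndmc T k n y" "ndmc S k n y"]
              by (simp add: distrib_right)
          qed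
          moreover have "?c + tail \<ge> 0"
          proof -
            have "norm (ndmc T k n x) / norm x \<le> ?c"
              using x by (intro dobrushin_coeff_bound nonid ndmc_norm_le[OF T1]) auto
            moreover have "0 \<le> norm (ndmc T k n x) / norm x" by simp
            moreover have "tail \<ge> 0" using partial[of k] by simp
            ultimately show ?thesis by linarith
          qed
          ultimately have "norm (ndmc S m n x) \<le> (?c + tail) * norm x"
            using ny by (metis mult_left_mono order_trans)
          then show ?thesis using x by (simp add: divide_le_eq)
        qed
        have "dobrushin_coeff P (ndmc S m n) \<le> ?c + tail"
          using nonid False bound by (auto simp: dobrushin_coeff_def intro!: cSUP_least)
        moreover have "dobrushin_coeff P (ndmc S m n) \<ge> 0"
        proof -
          obtain x where x: "P x = 0" "x \<noteq> 0" using False by auto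
          have "norm (ndmc S m n x) / norm x \<le> dobrushin_coeff P (ndmc S m n)"
            using x by (intro dobrushin_coeff_bound nonid ndmc_norm_le[OF S1])
          moreover have "0 \<le> norm (ndmc S m n x) / norm x" by simp
          ultimately show ?thesis by linarith
        qed
        ultimately show "norm (dobrushin_coeff P (ndmc S m n) - 0) < e"
          using M[of n] tail n by simp
      qed
    qed
  qed
qed

section \<open>Absorption by the limit projection\<close>

lemma tendsto_of_onorm_tendsto_0:
  fixes A :: "nat \<Rightarrow> 'a::real_normed_vector \<Rightarrow> 'b::real_normed_vector"
  assumes "\<And>n. n \<ge> 1 \<Longrightarrow> bounded_linear (A n)" "(\<lambda>n. onorm (A n)) \<longlonglongrightarrow> 0"
  shows "(\<lambda>n. A n x) \<longlonglongrightarrow> 0"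
proof (rule Lim_null_comparison)
  show "\<forall>\<^sub>F n in sequentially. norm (A n x) \<le> onorm (A n) * norm x"
    using eventually_ge_at_top[of 1] by eventually_elim (rule onorm[OF assms(1)])
  show "(\<lambda>n. onorm (A n) * norm x) \<longlonglongrightarrow> 0"
    using tendsto_mult_left_zero[OF assms(2)] .
qed

lemma left_decreasing_comp:
  assumes "left_decreasing Q" and idem: "\<And>n. n \<ge> 1 \<Longrightarrow> Q n \<circ> Q n = Q n"
    and "1 \<le> j" "j \<le> n"
  shows "Q n \<circ> Q j = Q n"
  using \<open>j \<le> n\<close>
proof (induction n rule: dec_induct)
  case base
  show ?case using idem \<open>1 \<le> j\<close> .
next
  case (step n)
  then have "Q (Suc n) \<circ> Q n = Q (Suc n)"
    using assms(1) \<open>1 \<le> j\<close> by (simp add: left_decreasing_def)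
  then show ?case using step.IH by (metis comp_assoc)
qed

lemma limit_projection_absorbs:
  fixes Q :: "nat \<Rightarrow> 'a::t2_space \<Rightarrow> 'a"
  assumes ld: "left_decreasing Q" and idem: "\<And>n. n \<ge> 1 \<Longrightarrow> Q n \<circ> Q n = Q n"
    and lim: "\<And>x. (\<lambda>n. Q n x) \<longlonglongrightarrow> L x"
    and R: "R \<circ> Q j = Q j \<circ> R" "R \<circ> Q j = Q j" and "1 \<le> j"
  shows "L (R x) = L x"
proof -
  have "Q n (R x) = Q n x" if "j \<le> n" for n
  proof -
    have "Q n \<circ> R = Q n \<circ> (Q j \<circ> R)"
      using left_decreasing_comp[OF ld idem \<open>1 \<le> j\<close> that] by (metis comp_assoc)
    also have "\<dots> = Q n" using R left_decreasing_comp[OF ld idem \<open>1 \<le> j\<close> that] by simp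
    finally show ?thesis by (metis comp_apply)
  qed
  then have "\<forall>\<^sub>F n in sequentially. Q n (R x) = Q n x"
    unfolding eventually_sequentially by blast
  then have "(\<lambda>n. Q n x) \<longlonglongrightarrow> L (R x)"
    using lim[of "R x"] by (rule Lim_transform_eventually[rotated])
  then show ?thesis using lim LIMSEQ_unique by blast
qed

section \<open>Equivalence of the two chains\<close>

theorem theorem6p10:
  fixes f :: "'a::{banach, ordered_real_vector} \<Rightarrow> real"
    and P Pbar T S :: "nat \<Rightarrow> 'a \<Rightarrow> 'a"
    and Plim :: "'a \<Rightarrow> 'a"
  assumes "abstract_state_space f"
    and "\<And>n. n \<ge> 1 \<Longrightarrow> markov_projection f (P n)"
    and "\<And>n. n \<ge> 1 \<Longrightarrow> markov_projection f (Pbar n)"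
    and "left_decreasing P"
    and "left_decreasing Pbar"
    and "(\<lambda>n. onorm (\<lambda>x. P n x - Pbar n x)) \<longlonglongrightarrow> 0"
    and "bounded_linear Plim"
    and "(\<lambda>n. onorm (\<lambda>x. P n x - Plim x)) \<longlonglongrightarrow> 0"
    and "\<And>n. n \<ge> 1 \<Longrightarrow> markov_operator f (T n)"
    and "\<And>n. n \<ge> 1 \<Longrightarrow> markov_operator f (S n)"
    and "\<And>n. n \<ge> 1 \<Longrightarrow> T n \<circ> P n = P n \<circ> T n"
    and "\<And>n. n \<ge> 1 \<Longrightarrow> S n \<circ> Pbar n = Pbar n \<circ> S n"
    and "\<And>n. n \<ge> 1 \<Longrightarrow> T n \<circ> P n = P n"
    and "\<And>n. n \<ge> 1 \<Longrightarrow> S n \<circ> Pbar n = Pbar n"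
    and "summable (\<lambda>n. onorm (\<lambda>x. T (Suc n) x - S (Suc n) x))"
  shows "weakly_ergodic Plim T \<longleftrightarrow> weakly_ergodic Plim S"
proof -
  note ass = assms(1)
  have lin: "linear R" and le1: "norm (R x) \<le> norm x" and bl: "bounded_linear R"
    if "markov_operator f R" for R x
  proof -
    show "linear R" using that by (simp add: markov_operator_def)
    then show "bounded_linear R"
      using markov_operator_norm_le[OF ass that] by (rule contraction_bounded_linear)
    show "norm (R x) \<le> norm x" by (rule markov_operator_norm_le[OF ass that])
  qed
  have P: "markov_operator f (P n)" "P n \<circ> P n = P n"
    and Pb: "markov_operator f (Pbar n)" "Pbar n \<circ> Pbar n = Pbar n" if "n \<ge> 1" for n
    using assms(2,3)[OF that] by (auto simp: markov_projection_def)
  have diff_lim: "(\<lambda>n. P n x - Plim x) \<longlonglongrightarrow> 0" for x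
    by (intro tendsto_of_onorm_tendsto_0[of "\<lambda>n x. P n x - Plim x"] assms(8)
        bounded_linear_sub bl P assms(7))
  have limP: "(\<lambda>n. P n x) \<longlonglongrightarrow> Plim x" for x
    using diff_lim[of x] by (simp add: LIM_zero_iff)
  have diff_bar: "(\<lambda>n. P n x - Pbar n x) \<longlonglongrightarrow> 0" for x
    by (intro tendsto_of_onorm_tendsto_0[of "\<lambda>n x. P n x - Pbar n x"] assms(6)
        bounded_linear_sub bl P Pb)
  have limPb: "(\<lambda>n. Pbar n x) \<longlonglongrightarrow> Plim x" for x
    using tendsto_diff[OF limP[of x] diff_bar[of x]] by simp
  have PT: "Plim (T n x) = Plim x" if "n \<ge> 1" for n x
    by (rule limit_projection_absorbs[OF assms(4) P(2) limP assms(11)[OF that] assms(13)[OF that] that])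
  have PS: "Plim (S n x) = Plim x" if "n \<ge> 1" for n x
    by (rule limit_projection_absorbs[OF assms(5) Pb(2) limPb assms(12)[OF that] assms(14)[OF that] that])
  have sym: "onorm (\<lambda>x. S (Suc n) x - T (Suc n) x) = onorm (\<lambda>x. T (Suc n) x - S (Suc n) x)" for n
    by (simp add: onorm_def norm_minus_commute)
  show ?thesis
  proof
    assume "weakly_ergodic Plim T"
    with assms(15) show "weakly_ergodic Plim S"
      by (intro weakly_ergodic_transfer[of T S Plim] lin le1 assms(9,10) PS)
  next
    assume "weakly_ergodic Plim S"
    moreover have "summable (\<lambda>n. onorm (\<lambda>x. S (Suc n) x - T (Suc n) x))"
      using assms(15) by (simp only: sym)
    ultimately show "weakly_ergodic Plim T"
      by (intro weakly_ergodic_transfer[of S T Plim] lin le1 assms(9,10) PT)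
  qed
qed

end
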